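(* Let $I=(\mathcal{L}(u,v))\subset S=k[x_1,\ldots,x_n]$, where $u=x_1^{a_1}\cdots x_n^{a_n}$ and $v=x_q^{b_q}\cdots x_n^{b_n}$ are monomials of degree $d\ge 2$ with $2\le q\le n$ and $a_1,b_q>0$. Then $\mathrm{depth}(S/I)=0$ if and only if $x_nu/x_1\geq_{lex} v$.
   Context: $S=k[x_1,\ldots,x_n]$ is a polynomial ring over a field $k$, with monomials ordered lexicographically with $x_1>x_2>\cdots>x_n$. $d\geq 2$ is an integer and $\mathcal{M}_d$ is the set of monomials of degree $d$ in $S$. For $u,v\in\mathcal{M}_d$ with $u\geq_{lex}v$, $\mathcal{L}(u,v)=\{w\in\mathcal{M}_d : u\geq_{lex}w\geq_{lex}v\}$. Depth is taken with respect to the graded maximal ideal $(x_1,\ldots,x_n)$. *)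

theory Defs
  imports "HOL-Library.Poly_Mapping" "HOL-Library.Extended_Nat" "HOL-Algebra.QuotRing" "HOL-Algebra.Module"
begin

section \<open>Monomials in \<open>x\<^sub>1, \<dots>, x\<^sub>n\<close> and the lexicographic order\<close>

text \<open>
  A monomial is represented by its exponent vector, a finitely supported function
  \<^typ>\<open>nat \<Rightarrow>\<^sub>0 nat\<close> whose support lies in \<open>{1..n}\<close>.  Hence products of monomials
  are sums of exponent vectors, and quotients are (pointwise truncated) differences; the latter
  are only meaningful if the divisor divides the dividend.
\<close>

type_synonym monom = "nat \<Rightarrow>\<^sub>0 nat"

definition var :: "nat \<Rightarrow> monom"
  where "var i = Poly_Mapping.single i 1"

definition mdeg :: "monom \<Rightarrow> nat"
  where "mdeg m = (\<Sum>i\<in>Poly_Mapping.keys m. Poly_Mapping.lookup m i)"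

definition monoms :: "nat \<Rightarrow> nat \<Rightarrow> monom set"
  where "monoms n d = {m. Poly_Mapping.keys m \<subseteq> {1..n} \<and> mdeg m = d}"

text \<open>
  The library order on \<^typ>\<open>nat \<Rightarrow>\<^sub>0 nat\<close> is the lexicographic order with
  \<open>x\<^sub>1 > x\<^sub>2 > \<dots> > x\<^sub>n\<close>:
\<close>

lemma monom_less_iff:
  fixes m m' :: monom
  shows "m < m' \<longleftrightarrow>
    (\<exists>i. Poly_Mapping.lookup m i < Poly_Mapping.lookup m' i \<and>
         (\<forall>j<i. Poly_Mapping.lookup m j = Poly_Mapping.lookup m' j))"
  by transfer (simp add: less_fun_def)

lemma var_less:
  assumes "i < j"
  shows "var j < var i"
  unfolding monom_less_iff var_def
  by (rule exI[of _ i]) (use assms in \<open>auto simp: lookup_single when_def\<close>)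

definition lexseg :: "nat \<Rightarrow> nat \<Rightarrow> monom \<Rightarrow> monom \<Rightarrow> monom set"
  where "lexseg n d u v = {w \<in> monoms n d. v \<le> w \<and> w \<le> u}"


section \<open>The polynomial ring \<open>k[x\<^sub>1, \<dots>, x\<^sub>n]\<close>\<close>

text \<open>
  The type \<^typ>\<open>monom \<Rightarrow>\<^sub>0 'k\<close> consists of the polynomials in infinitely many variables;
  the carrier restricts to those involving only \<open>x\<^sub>1, \<dots>, x\<^sub>n\<close>.
\<close>

definition poly_ring :: "nat \<Rightarrow> (monom \<Rightarrow>\<^sub>0 'k::comm_ring_1) ring"
  where "poly_ring n =
    \<lparr>carrier = {p. \<forall>m\<in>Poly_Mapping.keys p. Poly_Mapping.keys m \<subseteq> {1..n}},
     mult = (*), one = 1, zero = 0, add = (+)\<rparr>"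

definition monom_poly :: "monom \<Rightarrow> (monom \<Rightarrow>\<^sub>0 'k::comm_ring_1)"
  where "monom_poly m = Poly_Mapping.single m 1"

definition monom_ideal :: "nat \<Rightarrow> monom set \<Rightarrow> (monom \<Rightarrow>\<^sub>0 'k::comm_ring_1) set"
  where "monom_ideal n A = genideal (poly_ring n) (monom_poly ` A)"

definition graded_max_ideal :: "nat \<Rightarrow> (monom \<Rightarrow>\<^sub>0 'k::comm_ring_1) set"
  where "graded_max_ideal n = monom_ideal n (var ` {1..n})"

lemma poly_ring_simps [simp]:
  "mult (poly_ring n) = (*)" "one (poly_ring n) = 1"
  "zero (poly_ring n) = 0" "add (poly_ring n) = (+)"
  by (simp_all add: poly_ring_def)

lemma poly_ring_cring: "cring (poly_ring n :: (monom \<Rightarrow>\<^sub>0 'k::comm_ring_1) ring)"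
proof -
  let ?R = "poly_ring n :: (monom \<Rightarrow>\<^sub>0 'k) ring"
  have carrier: "p \<in> carrier ?R \<longleftrightarrow>
      (\<forall>m\<in>Poly_Mapping.keys p. Poly_Mapping.keys m \<subseteq> {1..n})" for p
    by (simp add: poly_ring_def)
  have zero: "0 \<in> carrier ?R" and one: "1 \<in> carrier ?R"
    by (simp_all add: carrier)
  have uminus: "- p \<in> carrier ?R" if "p \<in> carrier ?R" for p
    using that by (simp add: carrier)
  have add: "p + q \<in> carrier ?R" if "p \<in> carrier ?R" "q \<in> carrier ?R" for p q
    using that Poly_Mapping.keys_add[of p q] unfolding carrier by blast
  have mult: "p * q \<in> carrier ?R" if pq: "p \<in> carrier ?R" "q \<in> carrier ?R" for p q
    unfolding carrier
  proof
    fix m assume "m \<in> Poly_Mapping.keys (p * q)"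
    then obtain a b where ab: "m = a + b" "a \<in> Poly_Mapping.keys p" "b \<in> Poly_Mapping.keys q"
      using keys_mult[of p q] by blast
    then show "Poly_Mapping.keys m \<subseteq> {1..n}"
      using pq Poly_Mapping.keys_add[of a b] unfolding carrier by blast
  qed
  show ?thesis
  proof (rule cringI)
    show "abelian_group ?R"
    proof (rule abelian_groupI)
      fix p assume p: "p \<in> carrier ?R"
      show "\<exists>q\<in>carrier ?R. q \<oplus>\<^bsub>?R\<^esub> p = \<zero>\<^bsub>?R\<^esub>"
        by (rule bexI[of _ "- p"]) (simp_all add: uminus p)
    qed (simp_all add: zero add add_ac)
    show "Group.comm_monoid ?R"
      by (rule comm_monoidI) (simp_all add: one mult mult_ac)
  qed (simp add: distrib_right)
qed


section \<open>Regular sequences and depth\<close>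

text \<open>\<open>R/I\<close> as an \<open>R\<close>-module; \<open>r\<close> acts as multiplication by its residue class.\<close>

definition quot_module :: "('a, 'c) ring_scheme \<Rightarrow> 'a set \<Rightarrow> ('a, 'a set) module"
  where "quot_module R I =
    \<lparr>carrier = carrier (R Quot I), mult = mult (R Quot I), one = one (R Quot I),
     zero = zero (R Quot I), add = add (R Quot I),
     smult = (\<lambda>r X. (I +>\<^bsub>R\<^esub> r) \<otimes>\<^bsub>R Quot I\<^esub> X)\<rparr>"

lemma quot_module_module:
  assumes "cring R" and "ideal I R"
  shows "Module.module R (quot_module R I)"
proof -
  interpret I: ideal I R by fact
  interpret Q: cring "R Quot I" by (rule I.quotient_is_cring) fact
  interpret h: ring_hom_ring R "R Quot I" "(+>\<^bsub>R\<^esub>) I" by (rule I.rcos_ring_hom_ring)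
  have "abelian_group (quot_module R I)"
    by (rule abelian_groupI)
       (auto simp: quot_module_def Q.a_ac intro: Q.add.l_inv_ex)
  then show ?thesis
    by (intro Module.moduleI assms)
       (simp_all add: quot_module_def Q.l_distr Q.r_distr Q.m_assoc)
qed

text \<open>The submodule \<open>A M\<close> of \<open>M\<close> generated by all \<open>f \<odot> x\<close> with \<open>f \<in> A\<close> and \<open>x \<in> M\<close>.\<close>

definition set_smult ::
    "('a, 'c) ring_scheme \<Rightarrow> ('a, 'b, 'd) module_scheme \<Rightarrow> 'a set \<Rightarrow> 'b set"
  where "set_smult R M A =
    \<Inter>{N. submodule N R M \<and> (\<forall>f\<in>A. \<forall>x\<in>carrier M. f \<odot>\<^bsub>M\<^esub> x \<in> N)}"

text \<open>
  The sequence \<open>f\<^sub>1, \<dots>, f\<^sub>r\<close> is \<open>M\<close>-regular if every \<open>f\<^sub>i\<close> is a nonzerodivisor on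
  \<open>M/(f\<^sub>1, \<dots>, f\<^sub>i\<^sub>-\<^sub>1)M\<close> (spelled out on representatives in \<open>M\<close>), and
  \<open>M/(f\<^sub>1, \<dots>, f\<^sub>r)M \<noteq> 0\<close>.
\<close>

definition regular_seq ::
    "('a, 'c) ring_scheme \<Rightarrow> ('a, 'b, 'd) module_scheme \<Rightarrow> 'a list \<Rightarrow> bool"
  where "regular_seq R M fs \<longleftrightarrow>
    set fs \<subseteq> carrier R \<and>
    (\<forall>i<length fs. \<forall>x\<in>carrier M.
       fs ! i \<odot>\<^bsub>M\<^esub> x \<in> set_smult R M (set (take i fs)) \<longrightarrow> x \<in> set_smult R M (set (take i fs))) \<and>
    set_smult R M (set fs) \<noteq> carrier M"

text \<open>
  The depth of \<open>M\<close> with respect to an ideal \<open>J\<close> is the supremum of the lengths of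
  \<open>M\<close>-regular sequences in \<open>J\<close>, with the usual convention that it is \<open>\<infinity>\<close> if \<open>J M = M\<close>.
\<close>

definition depth ::
    "('a, 'c) ring_scheme \<Rightarrow> 'a set \<Rightarrow> ('a, 'b, 'd) module_scheme \<Rightarrow> enat"
  where "depth R J M =
    (if set_smult R M J = carrier M then \<infinity>
     else (SUP fs\<in>{fs. set fs \<subseteq> J \<and> regular_seq R M fs}. enat (length fs)))"

end

theory Submission
  imports Defs
begin

text \<open>
  Since $\mathrm{depth}(S/I) = 0$ means that every element of $(x_1, \ldots, x_n)$ is a zero
  divisor on $S/I$, put $w = u/x_1$, which is not in $I$ for degree reasons. If $x_n w \geq v$,
  then every $x_i w$ lies between $x_n w$ and $x_1 w = u$, so $w$ is annihilated by all variables
  modulo $I$.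

  Conversely let $x_n w < v$. As $v$ is not divisible by $x_1$, neither is $w$, so every generator
  has degree at most one in $x_1$. Then $x_1 + x_n$ is a nonzerodivisor on $S/I$: a monomial
  $m \notin I$ with $x_1 m \in I$ does not involve $x_1$, so that in a product $(x_1 + x_n) r$
  the contributions of $x_1$ and $x_n$ do not cancel, and no such $m$ satisfies $x_n m \in I$.
\<close>

section \<open>Depth zero for cyclic modules\<close>

lemma set_smult_mono:
  assumes "A \<subseteq> B"
  shows "set_smult R M A \<subseteq> set_smult R M B"
  unfolding set_smult_def using assms by blast

lemma (in module) set_smult_subset_carrier:
  assumes "A \<subseteq> carrier R"
  shows "set_smult R M A \<subseteq> carrier M"
  unfolding set_smult_def using assms carrier_is_submodule by blast

text \<open>\<open>regular_seq\<close> tests the first entry modulo the submodule for the empty set;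
  as this is zero, the test is the usual nonzerodivisor condition on \<open>M\<close>.\<close>

lemma (in module) set_smult_empty: "set_smult R M {} = {\<zero>\<^bsub>M\<^esub>}"
proof
  have "submodule {\<zero>\<^bsub>M\<^esub>} R M"
    by (rule submoduleI) auto
  then show "set_smult R M {} \<subseteq> {\<zero>\<^bsub>M\<^esub>}"
    unfolding set_smult_def by blast
  have "\<zero>\<^bsub>M\<^esub> \<in> N" if "submodule N R M" for N
    using subgroup.one_closed[OF submodule.axioms(1)[OF that]] by simp
  then show "{\<zero>\<^bsub>M\<^esub>} \<subseteq> set_smult R M {}"
    unfolding set_smult_def by blast
qed

section \<open>Computing in \<open>quot_module R I\<close> on coset representatives\<close>

lemma carrier_quot_module:
  "carrier (quot_module R I) = (\<lambda>r. I +>\<^bsub>R\<^esub> r) ` carrier R"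
  by (auto simp: quot_module_def FactRing_def A_RCOSETS_def')

lemma zero_quot_module: "\<zero>\<^bsub>quot_module R I\<^esub> = I"
  by (simp add: quot_module_def FactRing_def)

lemma (in ideal) smult_quot_module:
  assumes "f \<in> carrier R" "r \<in> carrier R"
  shows "f \<odot>\<^bsub>quot_module R I\<^esub> (I +> r) = I +> (f \<otimes> r)"
  using assms by (simp add: quot_module_def FactRing_def rcoset_mult_add)

lemma (in ideal) add_quot_module:
  assumes "r \<in> carrier R" "s \<in> carrier R"
  shows "(I +> r) \<oplus>\<^bsub>quot_module R I\<^esub> (I +> s) = I +> (r \<oplus> s)"
  using assms by (simp add: quot_module_def FactRing_def a_rcos_sum)

lemma (in ideal) rcos_eq_iff_mem:
  assumes "r \<in> carrier R"
  shows "I +> r = I \<longleftrightarrow> r \<in> I"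
  using assms a_rcos_const rcos_const_imp_mem by blast

text \<open>The image of \<open>J\<close> is a submodule containing all products. The class of 1
  lies outside it, because \<open>I \<subseteq> J\<close> keeps the coset of an element of
  \<open>J\<close> inside \<open>J\<close>. This rules out the infinite value of
  \<open>depth\<close>.\<close>

lemma set_smult_quot_module_proper:
  fixes R (structure)
  assumes R: "cring R" and I: "ideal I R" and J: "ideal J R" and "I \<subseteq> J" and "\<one> \<notin> J"
  shows "set_smult R (quot_module R I) J \<noteq> carrier (quot_module R I)"
proof -
  interpret R: cring R by fact
  interpret I: ideal I R by fact
  interpret J: ideal J R by fact
  let ?M = "quot_module R I"
  interpret M: Module.module R ?M by (rule quot_module_module) fact+
  let ?N = "(\<lambda>r. I +> r) ` J"
  have smult: "f \<odot>\<^bsub>?M\<^esub> x \<in> ?N" if "f \<in> carrier R" "x \<in> ?N" for f x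
    using that by (auto simp: I.smult_quot_module J.I_l_closed)
  have "submodule ?N R ?M"
  proof (rule M.submoduleI)
    show sub: "?N \<subseteq> carrier ?M"
      by (auto simp: carrier_quot_module)
    show "\<zero>\<^bsub>?M\<^esub> \<in> ?N"
      using I.rcos_eq_iff_mem[of \<zero>] by (force simp: zero_quot_module)
    fix x assume x: "x \<in> ?N"
    then have "\<ominus>\<^bsub>?M\<^esub> x = (\<ominus> \<one>) \<odot>\<^bsub>?M\<^esub> x"
      using sub by (subst M.smult_l_minus) auto
    then show "\<ominus>\<^bsub>?M\<^esub> x \<in> ?N"
      using smult[OF _ x, of "\<ominus> \<one>"] by simp
  next
    fix x y assume "x \<in> ?N" "y \<in> ?N"
    then show "x \<oplus>\<^bsub>?M\<^esub> y \<in> ?N"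
      by (auto simp: I.add_quot_module)
  qed (rule smult)
  moreover have "f \<odot>\<^bsub>?M\<^esub> x \<in> ?N" if "f \<in> J" "x \<in> carrier ?M" for f x
    using that by (auto simp: carrier_quot_module I.smult_quot_module J.I_r_closed)
  ultimately have "set_smult R ?M J \<subseteq> ?N"
    unfolding set_smult_def by blast
  moreover have "I +> \<one> \<notin> ?N"
  proof
    assume "I +> \<one> \<in> ?N"
    then obtain j where j: "j \<in> J" "I +> \<one> = I +> j" by blast
    then have "\<one> \<in> I +> j"
      using I.a_rcos_self[of \<one>] by simp
    then show False
      using \<open>I \<subseteq> J\<close> \<open>\<one> \<notin> J\<close> j(1) by (auto simp: a_r_coset_def')
  qed
  moreover have "I +> \<one> \<in> carrier ?M"
    by (auto simp: carrier_quot_module)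
  ultimately show ?thesis by blast
qed

text \<open>A nonempty regular sequence in \<open>J\<close> begins with a nonzerodivisor on R/I.
  Conversely, such an element of \<open>J\<close> alone is a regular sequence, since the submodule
  it generates lies in the proper one generated by \<open>J\<close>.\<close>

lemma depth_quot_eq_0_iff:
  fixes R (structure)
  assumes R: "cring R" and I: "ideal I R" and J: "ideal J R" and "I \<subseteq> J" and "\<one> \<notin> J"
  shows "depth R J (quot_module R I) = 0 \<longleftrightarrow>
         (\<forall>f\<in>J. \<exists>r\<in>carrier R - I. f \<otimes> r \<in> I)"
proof -
  interpret R: cring R by fact
  interpret I: ideal I R by fact
  interpret J: ideal J R by fact
  let ?M = "quot_module R I"
  interpret M: Module.module R ?M by (rule quot_module_module) fact+
  note proper = set_smult_quot_module_proper[OF assms]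
  let ?seqs = "{fs. set fs \<subseteq> J \<and> regular_seq R ?M fs}"
  have zerodiv: "\<exists>r\<in>carrier R - I. f \<otimes> r \<in> I"
    if none: "\<And>fs. fs \<in> ?seqs \<Longrightarrow> fs = []" and f: "f \<in> J" for f
  proof (rule ccontr)
    assume nz: "\<not> (\<exists>r\<in>carrier R - I. f \<otimes> r \<in> I)"
    have "set_smult R ?M {f} \<noteq> carrier ?M"
      using set_smult_mono[of "{f}" J R ?M] M.set_smult_subset_carrier[OF J.a_subset] proper f
      by auto
    moreover have "x \<in> {\<zero>\<^bsub>?M\<^esub>}" if x: "x \<in> carrier ?M" "f \<odot>\<^bsub>?M\<^esub> x \<in> {\<zero>\<^bsub>?M\<^esub>}" for x
    proof -
      obtain r where r: "r \<in> carrier R" "x = I +> r"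
        using x(1) by (auto simp: carrier_quot_module)
      with x(2) f have "f \<otimes> r \<in> I"
        by (simp add: zero_quot_module I.smult_quot_module I.rcos_eq_iff_mem)
      with nz r show ?thesis
        by (auto simp: zero_quot_module I.rcos_const_imp_mem I.rcos_eq_iff_mem simp del: I.a_rcos_const)
    qed
    ultimately have "regular_seq R ?M [f]"
      using f by (simp add: regular_seq_def M.set_smult_empty)
    then show False
      using none[of "[f]"] f by simp
  qed
  have none: "fs = []"
    if all: "\<forall>f\<in>J. \<exists>r\<in>carrier R - I. f \<otimes> r \<in> I" and fs: "fs \<in> ?seqs" for fs
  proof (rule ccontr)
    assume "fs \<noteq> []"
    then obtain f gs where fgs: "fs = f # gs" by (cases fs) auto
    with fs have f: "f \<in> J" by simp
    with all obtain r where r: "r \<in> carrier R" "r \<notin> I" "f \<otimes> r \<in> I" by blast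
    have "f \<odot>\<^bsub>?M\<^esub> x \<in> {\<zero>\<^bsub>?M\<^esub>} \<longrightarrow> x \<in> {\<zero>\<^bsub>?M\<^esub>}" if "x \<in> carrier ?M" for x
      using fs fgs that by (force simp: regular_seq_def M.set_smult_empty)
    from this[of "I +> r"] r f show False
      by (auto simp: carrier_quot_module zero_quot_module I.smult_quot_module I.rcos_eq_iff_mem)
  qed
  \<comment> \<open>\<open>proper\<close> excludes the infinite branch, and a supremum of lengths is
    0 exactly when all of them are.\<close>
  have "depth R J ?M = 0 \<longleftrightarrow> (\<forall>fs\<in>?seqs. fs = [])"
    using proper by (auto simp: depth_def SUP_bot_conv(1)[where 'a=enat, unfolded bot_enat_def] enat_0_iff)
  also have "\<dots> \<longleftrightarrow> (\<forall>f\<in>J. \<exists>r\<in>carrier R - I. f \<otimes> r \<in> I)"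
    using zerodiv none by blast
  finally show ?thesis .
qed

section \<open>Monomials and monomial ideals\<close>

lemma keys_add_monom:
  fixes m m' :: monom
  shows "Poly_Mapping.keys (m + m') = Poly_Mapping.keys m \<union> Poly_Mapping.keys m'"
  by (auto simp: in_keys_iff lookup_add)

lemma mdeg_add: "mdeg (m + m') = mdeg m + mdeg m'"
proof -
  let ?K = "Poly_Mapping.keys m \<union> Poly_Mapping.keys m'"
  have "mdeg m = (\<Sum>i\<in>?K. Poly_Mapping.lookup m i)"
       "mdeg m' = (\<Sum>i\<in>?K. Poly_Mapping.lookup m' i)"
    unfolding mdeg_def by (intro sum.mono_neutral_left; force simp: in_keys_iff)+
  then show ?thesis
    by (simp add: mdeg_def keys_add_monom lookup_add sum.distrib)
qed

lemma mdeg_var [simp]: "mdeg (var i) = 1"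
  by (simp add: mdeg_def var_def)

lemma keys_var [simp]: "Poly_Mapping.keys (var i) = {i}"
  by (simp add: var_def)

lemma mdeg_eq_0_iff: "mdeg m = 0 \<longleftrightarrow> m = 0"
proof
  assume "mdeg m = 0"
  then have "Poly_Mapping.lookup m i = 0" for i
    by (auto simp: mdeg_def in_keys_iff)
  then show "m = 0"
    by (intro poly_mapping_eqI) simp
qed (simp add: mdeg_def)

lemma lookup_var: "Poly_Mapping.lookup (var i) j = (if i = j then 1 else 0)"
  by (simp add: var_def lookup_single when_def)

lemma var_plus_minus_var:
  assumes "Poly_Mapping.lookup m i > 0"
  shows "var i + (m - var i) = m"
  by (rule poly_mapping_eqI) (use assms in \<open>auto simp: lookup_add lookup_minus lookup_var\<close>)

text \<open>Index 1 decides the comparison, because both supports avoid 0, the only index before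
  it.\<close>

lemma monom_less_if_lookup:
  fixes m m' :: monom
  assumes "Poly_Mapping.keys m \<subseteq> {1..n}" "Poly_Mapping.keys m' \<subseteq> {1..n}"
    and "Poly_Mapping.lookup m 1 < Poly_Mapping.lookup m' 1"
  shows "m < m'"
  unfolding monom_less_iff
proof (intro exI conjI allI impI)
  fix j :: nat assume "j < 1"
  then have "j \<notin> Poly_Mapping.keys m" "j \<notin> Poly_Mapping.keys m'"
    using assms(1,2) by auto
  then show "Poly_Mapping.lookup m j = Poly_Mapping.lookup m' j"
    by (simp add: in_keys_iff)
qed (fact assms(3))

text \<open>Upward closure under divisibility, in additive notation. The cofactor \<open>t\<close>
  may involve any variable; the carrier in \<open>monom_ideal_eq\<close> restricts to the first
  \<open>n\<close>.\<close>

definition monom_multiples :: "monom set \<Rightarrow> monom set"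
  where "monom_multiples A = {g + t |g t. g \<in> A}"

lemma subset_monom_multiples: "A \<subseteq> monom_multiples A"
  unfolding monom_multiples_def by (metis (mono_tags, lifting) add.right_neutral mem_Collect_eq subsetI)

lemma monom_multiples_add:
  assumes "m \<in> monom_multiples A"
  shows "t + m \<in> monom_multiples A"
proof -
  obtain g s where "g \<in> A" "m = g + s"
    using assms by (auto simp: monom_multiples_def)
  moreover from this have "t + m = g + (t + s)"
    by (simp add: add.left_commute)
  ultimately show ?thesis
    unfolding monom_multiples_def by blast
qed

lemma poly_mapping_sum_single:
  "(\<Sum>m\<in>Poly_Mapping.keys p. Poly_Mapping.single m (Poly_Mapping.lookup p m)) = p"
  by (rule poly_mapping_eqI)
     (auto simp: lookup_sum lookup_single when_def in_keys_iff sum.delta)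

lemma carrier_poly_ring:
  "p \<in> carrier (poly_ring n) \<longleftrightarrow> (\<forall>m\<in>Poly_Mapping.keys p. Poly_Mapping.keys m \<subseteq> {1..n})"
  by (simp add: poly_ring_def)

context
  fixes n :: nat and A :: "monom set" and R :: "(monom \<Rightarrow>\<^sub>0 'k::comm_ring_1) ring"
  defines "R \<equiv> poly_ring n"
  assumes A: "\<And>m. m \<in> A \<Longrightarrow> Poly_Mapping.keys m \<subseteq> {1..n}"
begin

interpretation R: cring R
  unfolding R_def by (rule poly_ring_cring)

lemma gens_in_carrier: "monom_poly ` A \<subseteq> carrier R"
  using A by (auto simp: R_def monom_poly_def carrier_poly_ring)

lemma monom_ideal_ideal: "ideal (monom_ideal n A) (poly_ring n :: (monom \<Rightarrow>\<^sub>0 'k) ring)"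
  using R.genideal_ideal[OF gens_in_carrier] by (simp add: monom_ideal_def R_def)

text \<open>Every monomial of a product is a product of monomials of the factors, so divisibility by
  a member of \<open>A\<close> is inherited. This ideal bounds the generated one from above.\<close>

lemma keys_multiples_ideal:
  "ideal {p \<in> carrier R. Poly_Mapping.keys p \<subseteq> monom_multiples A} R"
  (is "ideal ?J R")
proof (rule idealI)
  \<comment> \<open>The ring inverse is the pointwise negative, which leaves the support
    unchanged.\<close>
  have neg: "\<ominus>\<^bsub>R\<^esub> p = - p" if "p \<in> carrier R" for p
    using that by (intro R.minus_equality) (auto simp: R_def carrier_poly_ring)
  have add: "p + r \<in> ?J" if "p \<in> ?J" "r \<in> ?J" for p r
    using that R.add.m_closed[of p r] Poly_Mapping.keys_add[of p r] by (auto simp: R_def)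
  show "subgroup ?J (add_monoid R)"
  proof (rule R.add.subgroupI)
    show "?J \<noteq> {}"
      using R.zero_closed by (auto simp: R_def)
    show "\<ominus>\<^bsub>R\<^esub> p \<in> ?J" if "p \<in> ?J" for p
      using that R.a_inv_closed[of p] by (simp add: neg)
    show "p \<oplus>\<^bsub>R\<^esub> r \<in> ?J" if "p \<in> ?J" "r \<in> ?J" for p r
      using add[OF that] by (simp add: R_def)
  qed auto
  have mult: "r * p \<in> ?J" if "p \<in> ?J" "r \<in> carrier R" for p r
  proof -
    have "Poly_Mapping.keys (r * p) \<subseteq> monom_multiples A"
      using that keys_mult[of r p] monom_multiples_add by blast
    then show ?thesis
      using that R.m_closed[of r p] by (simp add: R_def)
  qed
  show "r \<otimes>\<^bsub>R\<^esub> p \<in> ?J" if "p \<in> ?J" "r \<in> carrier R" for p r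
    using mult[OF that] by (simp add: R_def)
  show "p \<otimes>\<^bsub>R\<^esub> r \<in> ?J" if "p \<in> ?J" "r \<in> carrier R" for p r
    using mult[OF that] by (simp add: R_def mult.commute)
qed (rule R.ring_axioms)

text \<open>One inclusion is minimality of the generated ideal. For the other, \<open>p\<close> is
  the sum of its terms, each of which is a generator times a term of the ring.\<close>

lemma monom_ideal_eq:
  "monom_ideal n A =
     {p \<in> carrier (poly_ring n :: (monom \<Rightarrow>\<^sub>0 'k) ring). Poly_Mapping.keys p \<subseteq> monom_multiples A}"
  (is "_ = ?J")
proof
  have "monom_poly ` A \<subseteq> ?J"
    using gens_in_carrier subset_monom_multiples[of A] by (auto simp: R_def monom_poly_def)
  then show "monom_ideal n A \<subseteq> ?J"
    using R.genideal_minimal[OF keys_multiples_ideal] by (simp add: monom_ideal_def R_def)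
  interpret I: ideal "monom_ideal n A" R
    using monom_ideal_ideal by (simp add: R_def)
  show "?J \<subseteq> monom_ideal n A"
  proof
    fix p assume p: "p \<in> ?J"
    let ?term = "\<lambda>m. Poly_Mapping.single m (Poly_Mapping.lookup p m)"
    have "?term m \<in> monom_ideal n A" if m: "m \<in> Poly_Mapping.keys p" for m
    proof -
      obtain g t where g: "g \<in> A" and mgt: "m = g + t"
        using p m by (auto simp: monom_multiples_def)
      have "(monom_poly g :: monom \<Rightarrow>\<^sub>0 'k) \<in> monom_ideal n A"
        unfolding monom_ideal_def
        by (rule subsetD[OF R.genideal_self[OF gens_in_carrier, unfolded R_def]]) (rule imageI[OF g])
      \<comment> \<open>A divisor of \<open>m\<close> involves only variables of \<open>m\<close>,
        so the cofactor term lies in the ring.\<close>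
      moreover have "Poly_Mapping.keys m \<subseteq> {1..n}"
        using p m by (simp add: carrier_poly_ring)
      then have "Poly_Mapping.single t (Poly_Mapping.lookup p m) \<in> carrier R"
        by (simp add: R_def carrier_poly_ring mgt keys_add_monom)
      ultimately have "monom_poly g * Poly_Mapping.single t (Poly_Mapping.lookup p m)
          \<in> monom_ideal n A"
        using I.I_r_closed by (fastforce simp: R_def)
      then show ?thesis
        by (simp add: monom_poly_def mult_single mgt)
    qed
    moreover have "(\<Sum>m\<in>K. ?term m) \<in> monom_ideal n A"
      if "finite K" "\<And>m. m \<in> K \<Longrightarrow> ?term m \<in> monom_ideal n A" for K
      using that
    proof (induction K)
      case empty
      then show ?case using I.zero_closed by (simp add: R_def)
    next
      case (insert m K)
      then have "?term m \<oplus>\<^bsub>R\<^esub> (\<Sum>m\<in>K. ?term m) \<in> monom_ideal n A"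
        by (intro I.a_closed) auto
      with insert show ?case by (simp add: R_def)
    qed
    ultimately have "(\<Sum>m\<in>Poly_Mapping.keys p. ?term m) \<in> monom_ideal n A"
      by simp
    then show "p \<in> monom_ideal n A"
      by (simp add: poly_mapping_sum_single)
  qed
qed

end

section \<open>The nonzerodivisor $x_1 + x_n$\<close>

text \<open>Multiplication by a monomial shifts coefficients, as exponent vectors are
  cancellative.\<close>

lemma lookup_monom_poly_mult:
  fixes t m :: monom
  shows "Poly_Mapping.lookup (monom_poly t * p) (t + m) = Poly_Mapping.lookup p m"
  by (simp add: monom_poly_def lookup_mult lookup_single when_mult mult_when)

lemma lookup_monom_poly_mult_eq_0:
  assumes "\<And>m. k = t + m \<Longrightarrow> m \<notin> Poly_Mapping.keys p"
  shows "Poly_Mapping.lookup (monom_poly t * p) k = 0"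
  using assms keys_mult[of "monom_poly t" p]
  by (auto simp: monom_poly_def in_keys_iff)

text \<open>For a suitable monomial \<open>m\<close> of \<open>r\<close> outside the ideal,
  \<open>var 1 + m\<close> is first forced into the ideal. By \<open>lookup_0\<close>,
  \<open>m\<close> then lacks x_1, so the coefficient at \<open>var n + m\<close> survives in the
  product, and \<open>colon\<close> gives a contradiction.\<close>

lemma var_1_plus_var_nonzerodivisor:
  fixes r :: "monom \<Rightarrow>\<^sub>0 'k::comm_ring_1"
  assumes "n \<noteq> 1"
    and lookup_0: "\<And>m. var 1 + m \<in> monom_multiples A \<Longrightarrow> m \<notin> monom_multiples A
           \<Longrightarrow> Poly_Mapping.lookup m 1 = 0"
    and keys: "\<And>m. m \<in> Poly_Mapping.keys r \<Longrightarrow> Poly_Mapping.keys m \<subseteq> {1..n}"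
    and colon: "\<And>m. Poly_Mapping.keys m \<subseteq> {1..n} \<Longrightarrow> var 1 + m \<in> monom_multiples A \<Longrightarrow> var n + m \<in> monom_multiples A
           \<Longrightarrow> m \<in> monom_multiples A"
    and prod: "Poly_Mapping.keys ((monom_poly (var 1) + monom_poly (var n)) * r) \<subseteq> monom_multiples A"
  shows "Poly_Mapping.keys r \<subseteq> monom_multiples A"
proof (rule ccontr)
  assume not_subset: "\<not> Poly_Mapping.keys r \<subseteq> monom_multiples A"
  define B where "B = Poly_Mapping.keys r - monom_multiples A"
  have "finite B" "B \<noteq> {}"
    using not_subset by (auto simp: B_def)
  let ?e = "\<lambda>m::monom. Poly_Mapping.lookup m 1"
  \<comment> \<open>Maximality in $x_1$ keeps the coefficient of $x_1 m$ in the product from being cancelled by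
     a term $x_n m'$, as $m'$ would have a larger exponent of $x_1$.\<close>
  obtain m where m: "m \<in> B" and max: "\<And>m'. m' \<in> B \<Longrightarrow> ?e m' \<le> ?e m"
  proof -
    have "Max (?e ` B) \<in> ?e ` B"
      using \<open>finite B\<close> \<open>B \<noteq> {}\<close> by simp
    then obtain m where "m \<in> B" "Max (?e ` B) = ?e m" by blast
    then show thesis
      using Max_ge[of "?e ` B"] \<open>finite B\<close> by (intro that[of m]) auto
  qed
  have coeff: "Poly_Mapping.lookup ((monom_poly (var 1) + monom_poly (var n)) * r) k =
      Poly_Mapping.lookup (monom_poly (var 1) * r) k + Poly_Mapping.lookup (monom_poly (var n) * r) k" for k
    by (simp add: distrib_right lookup_add)
  have r_m: "Poly_Mapping.lookup r m \<noteq> 0"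
    using m by (simp add: B_def in_keys_iff)
  have var1: "var 1 + m \<in> monom_multiples A"
  proof (rule ccontr)
    assume notin: "var 1 + m \<notin> monom_multiples A"
    have "Poly_Mapping.lookup (monom_poly (var n) * r) (var 1 + m) = 0"
    proof (rule lookup_monom_poly_mult_eq_0)
      fix m' assume eq: "var 1 + m = var n + m'"
      then have "?e m' = Suc (?e m)"
        using \<open>n \<noteq> 1\<close> by (auto simp: poly_mapping_eq_iff fun_eq_iff lookup_add lookup_var dest: spec[of _ 1])
      then have "m' \<notin> B"
        using max[of m'] by auto
      moreover have "m' \<notin> monom_multiples A"
        using notin monom_multiples_add[of m' A "var n"] eq by metis
      ultimately show "m' \<notin> Poly_Mapping.keys r"
        by (simp add: B_def)
    qed
    then have "var 1 + m \<in> Poly_Mapping.keys ((monom_poly (var 1) + monom_poly (var n)) * r)"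
      using r_m unfolding in_keys_iff coeff lookup_monom_poly_mult by simp
    with prod notin show False by blast
  qed
  have e0: "?e m = 0"
    using lookup_0[OF var1] m by (simp add: B_def)
  \<comment> \<open>Neither \<open>m\<close> nor x_n involves x_1, so the summand
    \<open>monom_poly (var 1) * r\<close> contributes nothing here.\<close>
  have "Poly_Mapping.lookup (monom_poly (var 1) * r) (var n + m) = 0"
  proof (rule lookup_monom_poly_mult_eq_0)
    fix m' assume "var n + m = var 1 + m'"
    then have "?e (var n + m) = ?e (var 1 + m')" by simp
    with e0 \<open>n \<noteq> 1\<close> show "m' \<notin> Poly_Mapping.keys r"
      by (simp add: lookup_add lookup_var)
  qed
  then have "var n + m \<in> Poly_Mapping.keys ((monom_poly (var 1) + monom_poly (var n)) * r)"
    using r_m unfolding in_keys_iff coeff lookup_monom_poly_mult by simp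
  with prod have "var n + m \<in> monom_multiples A" by blast
  moreover have "Poly_Mapping.keys m \<subseteq> {1..n}"
    using m keys by (simp add: B_def)
  ultimately have "m \<in> monom_multiples A"
    using colon var1 by blast
  with m show False by (simp add: B_def)
qed

section \<open>Lexicographic segments\<close>

lemma lexseg_keys: "g \<in> lexseg n d u v \<Longrightarrow> Poly_Mapping.keys g \<subseteq> {1..n}"
  by (auto simp: lexseg_def monoms_def)

text \<open>The witness \<open>c\<close> expresses degree \<open>d - 1\<close> without truncated
  subtraction, which would give a false equivalence at \<open>d = 0\<close>.\<close>

lemma var_plus_monoms_iff:
  assumes "i \<in> {1..n}"
  shows "var i + m \<in> monoms n d \<longleftrightarrow> (\<exists>c. d = Suc c \<and> m \<in> monoms n c)"
  using assms by (auto simp: monoms_def mdeg_add keys_add_monom)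

lemma mdeg_monom_multiples:
  assumes "m \<in> monom_multiples (lexseg n d u v)"
  shows "mdeg m \<ge> d"
  using assms by (auto simp: monom_multiples_def lexseg_def monoms_def mdeg_add)

text \<open>Adding \<open>w\<close> preserves the order of the variables. Hence every variable
  annihilates \<open>w\<close> modulo the segment ideal.\<close>

lemma var_plus_in_lexseg:
  assumes "v \<le> w + var n" and "var 1 + w \<in> monoms n d" and "i \<in> {1..n}"
  shows "var i + w \<in> lexseg n d (var 1 + w) v"
proof -
  have mono: "var j \<le> var i" if "i \<le> j" for i j
    using var_less[of i j] that by (cases "i = j") auto
  have "v \<le> var i + w"
    using mono[of i n] assms by (auto simp: add.commute intro: order_trans add_right_mono)
  moreover have "var i + w \<le> var 1 + w"
    using mono[of 1 i] assms(3) by (intro add_right_mono) auto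
  moreover have "var i + w \<in> monoms n d"
    using assms(2,3) by (auto simp: var_plus_monoms_iff)
  ultimately show ?thesis
    by (simp add: lexseg_def)
qed

section \<open>Colon properties of the segment below \<open>var 1 + w\<close> when
  \<open>var n + w < v\<close>\<close>

context
  fixes n d :: nat and w v :: monom
  assumes n: "n \<noteq> 1" and w: "var 1 + w \<in> monoms n d" and w1: "Poly_Mapping.lookup w 1 = 0"
    and less: "var n + w < v"
begin

text \<open>A generator \<open>g\<close> dividing \<open>var 1 + m\<close> but not \<open>m\<close>
  must absorb the factor x_1. The bound \<open>var 1 + w\<close> lets \<open>g\<close> contain x_1
  only once, and cancelling x_1 in that bound yields \<open>h \<le> w\<close>.\<close>

lemma lexseg_multiple_quotient_var_1:
  assumes m: "var 1 + m \<in> monom_multiples (lexseg n d (var 1 + w) v)"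
    "m \<notin> monom_multiples (lexseg n d (var 1 + w) v)"
  shows "Poly_Mapping.lookup m 1 = 0"
    and "\<exists>h t. m = h + t \<and> mdeg h + 1 = d \<and> h \<le> w"
proof -
  let ?L = "lexseg n d (var 1 + w) v"
  obtain g t where g: "g \<in> ?L" and eq: "var 1 + m = g + t"
    using m(1) by (auto simp: monom_multiples_def)
  \<comment> \<open>A factor x_1 of the cofactor \<open>t\<close> could be cancelled, making
    \<open>g\<close> divide \<open>m\<close>.\<close>
  have t1: "Poly_Mapping.lookup t 1 = 0"
  proof (rule ccontr)
    assume "Poly_Mapping.lookup t 1 \<noteq> 0"
    then have "t = var 1 + (t - var 1)"
      by (simp add: var_plus_minus_var)
    with eq have "var 1 + m = var 1 + (g + (t - var 1))"
      by (metis add.left_commute)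
    then have "m = g + (t - var 1)" by simp
    with g m(2) show False by (auto simp: monom_multiples_def)
  qed
  \<comment> \<open>The top \<open>var 1 + w\<close> has exponent 1 at x_1, and any larger exponent
    would exceed it.\<close>
  have g_le: "Poly_Mapping.lookup g 1 \<le> 1"
  proof (rule ccontr)
    assume "\<not> ?thesis"
    then have "var 1 + w < g"
      using g w w1 by (intro monom_less_if_lookup[where n = n])
        (auto simp: lexseg_def monoms_def lookup_add lookup_var)
    with g show False by (auto simp: lexseg_def)
  qed
  have "Poly_Mapping.lookup (var 1 + m) 1 = Poly_Mapping.lookup (g + t) 1"
    by (subst eq) (rule refl)
  then have eq1: "Poly_Mapping.lookup g 1 = Suc (Poly_Mapping.lookup m 1)"
    using t1 by (simp add: lookup_add lookup_var)
  with g_le show "Poly_Mapping.lookup m 1 = 0" by simp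
  define h where "h = g - var 1"
  have gh: "g = var 1 + h"
    using eq1 by (simp add: h_def var_plus_minus_var)
  have "var 1 + m = var 1 + (h + t)"
    using eq by (simp add: gh add.assoc)
  then have "m = h + t" by simp
  moreover have "h \<le> w" and "mdeg h + 1 = d"
    using g by (auto simp: gh lexseg_def monoms_def mdeg_add)
  ultimately show "\<exists>h t. m = h + t \<and> mdeg h + 1 = d \<and> h \<le> w" by blast
qed

text \<open>If \<open>var n + m\<close> is itself a generator, then \<open>h \<le> w\<close> places
  it below \<open>v\<close>. Otherwise a generator properly dividing it can be exchanged for one
  dividing \<open>m\<close>.\<close>

lemma lexseg_colon:
  assumes keys: "Poly_Mapping.keys m \<subseteq> {1..n}"
    and m: "var 1 + m \<in> monom_multiples (lexseg n d (var 1 + w) v)"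
    "var n + m \<in> monom_multiples (lexseg n d (var 1 + w) v)"
  shows "m \<in> monom_multiples (lexseg n d (var 1 + w) v)"
proof (rule ccontr)
  let ?L = "lexseg n d (var 1 + w) v"
  assume notin: "\<not> ?thesis"
  note quot = lexseg_multiple_quotient_var_1[OF m(1) notin]
  from quot(2) obtain h t where h: "m = h + t" "mdeg h + 1 = d" "h \<le> w" by blast
  from m(2) obtain g s where g: "g \<in> ?L" and eq: "var n + m = g + s"
    by (auto simp: monom_multiples_def)
  \<comment> \<open>A factor x_n of \<open>s\<close> would cancel and leave \<open>g\<close>
    dividing \<open>m\<close>; hence the factor x_n sits in \<open>g\<close>.\<close>
  have sn: "Poly_Mapping.lookup s n = 0"
  proof (rule ccontr)
    assume "Poly_Mapping.lookup s n \<noteq> 0"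
    then have "s = var n + (s - var n)"
      by (simp add: var_plus_minus_var)
    with eq have "var n + m = var n + (g + (s - var n))"
      by (metis add.left_commute)
    then have "m = g + (s - var n)" by simp
    with g notin show False by (auto simp: monom_multiples_def)
  qed
  have "Poly_Mapping.lookup (var n + m) n = Poly_Mapping.lookup (g + s) n"
    by (subst eq) (rule refl)
  then have "Poly_Mapping.lookup g n > 0"
    using sn by (simp add: lookup_add lookup_var)
  then obtain g' where g': "g = var n + g'"
    using var_plus_minus_var by metis
  have "var n + m = var n + (g' + s)"
    using eq by (simp add: g' add.assoc)
  then have mg: "m = g' + s" by simp
  show False
  proof (cases "s = 0")
    case True
    \<comment> \<open>Degrees force \<open>t\<close> to be trivial, so \<open>m\<close> equals
      \<open>h\<close> and inherits its bound \<open>w\<close>.\<close>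
    have "mdeg m + 1 = d"
      using g by (simp add: mg True g' lexseg_def monoms_def mdeg_add)
    with h have "mdeg t = 0"
      by (simp add: mdeg_add)
    with h have "m \<le> w"
      by (simp add: mdeg_eq_0_iff)
    then have "var n + m \<le> var n + w"
      by (rule add_left_mono)
    then have "var n + m < v"
      using less by (rule le_less_trans)
    with g show False
      by (auto simp: mg True g' lexseg_def)
  next
    case False
    then have "Poly_Mapping.keys s \<noteq> {}"
      by simp
    then obtain j where j: "Poly_Mapping.lookup s j > 0"
      by (metis ex_in_conv gr0I in_keys_iff)
    then have s: "s = var j + (s - var j)"
      by (simp add: var_plus_minus_var)
    define g0 where "g0 = var j + g'"
    \<comment> \<open>As $j < n$, exchanging the factor $x_n$ of $g$ for $x_j$ moves up in the segment.\<close>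
    have m_eq: "m = g0 + (s - var j)"
      using s by (metis mg g0_def add.assoc add.commute)
    have "j \<in> Poly_Mapping.keys s"
      using j by (simp add: in_keys_iff)
    then have "j \<in> {1..n}"
      using keys unfolding mg keys_add_monom by blast
    moreover have "j \<noteq> n"
      using j sn by auto
    ultimately have "g \<le> g0"
      unfolding g' g0_def using var_less[of j n] by (intro add_right_mono) auto
    moreover have "g0 \<in> monoms n d"
      using g \<open>j \<in> {1..n}\<close> by (auto simp: g' g0_def lexseg_def var_plus_monoms_iff)
    \<comment> \<open>\<open>g0\<close> divides \<open>m\<close> and so lacks x_1, whereas
      \<open>var 1 + w\<close> contains it.\<close>
    moreover have "g0 < var 1 + w"
    proof (rule monom_less_if_lookup)
      show "Poly_Mapping.lookup g0 1 < Poly_Mapping.lookup (var 1 + w) 1"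
        using quot(1) by (subst (asm) m_eq) (simp add: lookup_add lookup_var)
    qed (use \<open>g0 \<in> monoms n d\<close> w in \<open>auto simp: monoms_def\<close>)
    ultimately have "g0 \<in> ?L"
      using g by (auto simp: lexseg_def)
    with m_eq notin show False
      by (auto simp: monom_multiples_def)
  qed
qed

end

section \<open>The depth criterion for the segment ideal\<close>

theorem proposition3p2:
  fixes n d q :: nat
    and a b :: "nat \<Rightarrow> nat"
    and u v :: monom
    and S :: "(monom \<Rightarrow>\<^sub>0 'k::field) ring"
    and I :: "(monom \<Rightarrow>\<^sub>0 'k) set"
  defines "S \<equiv> poly_ring n"
    and "u \<equiv> (\<Sum>i=1..n. Poly_Mapping.single i (a i))"
    and "v \<equiv> (\<Sum>i=q..n. Poly_Mapping.single i (b i))"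
    and "I \<equiv> monom_ideal n (lexseg n d u v)"
  assumes "d \<ge> 2" and "2 \<le> q" and "q \<le> n"
    and "a 1 > 0" and "b q > 0"
    and "u \<in> monoms n d" and "v \<in> monoms n d"
  shows "depth S (graded_max_ideal n) (quot_module S I) = 0 \<longleftrightarrow>
         v \<le> u + var n - var 1"
proof -
  let ?L = "lexseg n d u v" and ?V = "var ` {1..n}"
  let ?J = "graded_max_ideal n :: (monom \<Rightarrow>\<^sub>0 'k) set"
  have keys_V: "Poly_Mapping.keys m \<subseteq> {1..n}" if "m \<in> ?V" for m
    using that by auto
  have I_eq: "p \<in> I \<longleftrightarrow> p \<in> carrier S \<and> Poly_Mapping.keys p \<subseteq> monom_multiples ?L" for p
    unfolding I_def S_def by (subst monom_ideal_eq) (use lexseg_keys in blast)+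
  have J_eq: "p \<in> ?J \<longleftrightarrow> p \<in> carrier S \<and> Poly_Mapping.keys p \<subseteq> monom_multiples ?V" for p
    unfolding graded_max_ideal_def S_def by (subst monom_ideal_eq) (use keys_V in auto)
  have ideal_I: "ideal I S"
    unfolding I_def S_def by (rule monom_ideal_ideal) (rule lexseg_keys)
  have ideal_J: "ideal ?J S"
    unfolding graded_max_ideal_def S_def by (rule monom_ideal_ideal) (rule keys_V)
  \<comment> \<open>Segment members have positive degree, so a variable divides each. This gives the
    containment of ideals that the depth criterion requires.\<close>
  have "?L \<subseteq> monom_multiples ?V"
  proof
    fix g assume g: "g \<in> ?L"
    then have "g \<noteq> 0"
      using \<open>d \<ge> 2\<close> by (auto simp: lexseg_def monoms_def mdeg_def)
    then obtain i where "i \<in> Poly_Mapping.keys g"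
      using keys_eq_empty by blast
    then have "g = var i + (g - var i)" "i \<in> {1..n}"
      using lexseg_keys[OF g] by (simp add: var_plus_minus_var in_keys_iff, blast)
    then show "g \<in> monom_multiples ?V"
      unfolding monom_multiples_def by blast
  qed
  then have "monom_multiples ?L \<subseteq> monom_multiples ?V"
    by (fastforce simp: monom_multiples_def add.assoc)
  then have "I \<subseteq> ?J"
    using I_eq J_eq by blast
  \<comment> \<open>The exponent vector \<open>0\<close> is the monomial 1, while multiples of a
    variable have positive degree.\<close>
  have "0 \<notin> monom_multiples ?V"
  proof
    assume "0 \<in> monom_multiples ?V"
    then obtain i t where "0 = var i + t"
      by (auto simp: monom_multiples_def)
    then have "mdeg 0 = mdeg (var i + t)" by simp
    then show False
      by (simp add: mdeg_add mdeg_eq_0_iff[THEN iffD2])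
  qed
  then have one: "1 \<notin> ?J"
    by (simp add: J_eq)
  have depth_0_iff: "depth S ?J (quot_module S I) = 0 \<longleftrightarrow>
      (\<forall>f\<in>?J. \<exists>r\<in>carrier S - I. f * r \<in> I)"
    using depth_quot_eq_0_iff[OF _ ideal_I ideal_J \<open>I \<subseteq> ?J\<close>] one poly_ring_cring[of n]
    by (simp add: S_def)

  have lookup_sum_single:
    "Poly_Mapping.lookup (\<Sum>i=k..n. Poly_Mapping.single i (c i)) 1 = (if k \<le> 1 \<and> 1 \<le> n then c 1 else 0)"
    for k and c :: "nat \<Rightarrow> nat"
    by (simp add: lookup_sum lookup_single when_def sum.delta)
  \<comment> \<open>The sum for \<open>v\<close> starts at \<open>q\<close>, which is at least 2, so
    x_1 does not occur in \<open>v\<close>.\<close>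
  have u1: "Poly_Mapping.lookup u 1 > 0" and v1: "Poly_Mapping.lookup v 1 = 0"
    using assms(5-9) unfolding u_def v_def by (simp_all add: lookup_sum_single del: One_nat_def)
  have "n \<noteq> 1"
    using \<open>2 \<le> q\<close> \<open>q \<le> n\<close> by simp
  define w where "w = u - var 1"
  have u: "u = var 1 + w"
    using u1 by (simp add: w_def var_plus_minus_var)
  \<comment> \<open>As x_1 divides \<open>u\<close>, the truncated difference is a genuine
    quotient.\<close>
  have w_n: "u + var n - var 1 = w + var n"
    by (simp add: u add.assoc)
  have w: "w \<in> monoms n (d - 1)"
    using \<open>u \<in> monoms n d\<close> \<open>q \<le> n\<close> \<open>2 \<le> q\<close> by (auto simp: u var_plus_monoms_iff)

  show ?thesis
    unfolding depth_0_iff w_n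
  proof
    assume v: "v \<le> w + var n"
    let ?w = "monom_poly w :: monom \<Rightarrow>\<^sub>0 'k"
    have w_carrier: "?w \<in> carrier S"
      using w by (auto simp: S_def carrier_poly_ring monom_poly_def monoms_def)
    \<comment> \<open>\<open>w\<close> has degree \<open>d - 1\<close>, below the common degree
      \<open>d\<close> of the generators.\<close>
    have "w \<notin> monom_multiples ?L"
      using mdeg_monom_multiples[of w n d u v] w \<open>d \<ge> 2\<close> by (auto simp: monoms_def)
    then have "?w \<notin> I"
      by (simp add: I_eq monom_poly_def)
    moreover have "f * ?w \<in> I" if f: "f \<in> ?J" for f
    proof -
      \<comment> \<open>Each monomial of \<open>f\<close> contains some x_i, and
        \<open>var i + w\<close> is already a generator.\<close>
      have "m + w \<in> monom_multiples ?L" if m: "m \<in> monom_multiples ?V" for m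
      proof -
        obtain i t where i: "i \<in> {1..n}" "m = var i + t"
          using m unfolding monom_multiples_def by blast
        then have "var i + w \<in> ?L"
          using var_plus_in_lexseg[OF v] \<open>u \<in> monoms n d\<close> by (simp add: u)
        moreover have "m + w = (var i + w) + t"
          by (simp add: i ac_simps)
        ultimately show ?thesis
          unfolding monom_multiples_def by blast
      qed
      then have "Poly_Mapping.keys (f * ?w) \<subseteq> monom_multiples ?L"
        using f keys_mult[of f ?w] by (fastforce simp: J_eq monom_poly_def)
      moreover have "f * ?w \<in> carrier S"
        using ideal.I_r_closed[OF ideal_J f w_carrier] by (simp add: J_eq S_def)
      ultimately show ?thesis
        by (simp add: I_eq)
    qed
    ultimately show "\<forall>f\<in>?J. \<exists>r\<in>carrier S - I. f * r \<in> I"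
      using w_carrier by blast
  next
    assume zerodiv: "\<forall>f\<in>?J. \<exists>r\<in>carrier S - I. f * r \<in> I"
    show "v \<le> w + var n"
    proof (rule ccontr)
      assume "\<not> ?thesis"
      then have less: "var n + w < v"
        by (simp add: add.commute)
      \<comment> \<open>If x_1 divided \<open>w\<close>, then \<open>var n + w\<close> would exceed
        \<open>v\<close>, in which x_1 does not occur.\<close>
      have w1: "Poly_Mapping.lookup w 1 = 0"
      proof (rule ccontr)
        assume "Poly_Mapping.lookup w 1 \<noteq> 0"
        then have "v < var n + w"
          using v1 w \<open>v \<in> monoms n d\<close> \<open>q \<le> n\<close> \<open>2 \<le> q\<close>
          by (intro monom_less_if_lookup[where n = n])
            (auto simp: monoms_def keys_add_monom lookup_add)
        with less show False by simp
      qed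
      let ?f = "monom_poly (var 1) + monom_poly (var n) :: monom \<Rightarrow>\<^sub>0 'k"
      have "monom_poly (var i) \<in> ?J" if "i \<in> {1..n}" for i
        using that subset_monom_multiples[of ?V] keys_V
        by (auto simp: J_eq S_def carrier_poly_ring monom_poly_def)
      then have "?f \<in> ?J"
        using additive_subgroup.a_closed[OF ideal.axioms(1)[OF ideal_J]] \<open>q \<le> n\<close> \<open>2 \<le> q\<close>
        by (simp add: S_def)
      then obtain r where r: "r \<in> carrier S" "r \<notin> I" "?f * r \<in> I"
        using zerodiv by blast
      have "Poly_Mapping.keys r \<subseteq> monom_multiples ?L"
      proof (rule var_1_plus_var_nonzerodivisor[OF \<open>n \<noteq> 1\<close>])
        note seg = \<open>n \<noteq> 1\<close> \<open>u \<in> monoms n d\<close>[unfolded u] w1 less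
        show "Poly_Mapping.lookup m 1 = 0"
          if "var 1 + m \<in> monom_multiples ?L" "m \<notin> monom_multiples ?L" for m
          using lexseg_multiple_quotient_var_1(1)[OF seg] that unfolding u by blast
        show "m \<in> monom_multiples ?L"
          if "Poly_Mapping.keys m \<subseteq> {1..n}" "var 1 + m \<in> monom_multiples ?L"
            "var n + m \<in> monom_multiples ?L" for m
          using lexseg_colon[OF seg] that unfolding u by blast
        show "Poly_Mapping.keys m \<subseteq> {1..n}" if "m \<in> Poly_Mapping.keys r" for m
          using r(1) that by (simp add: S_def carrier_poly_ring)
        show "Poly_Mapping.keys (?f * r) \<subseteq> monom_multiples ?L"
          using r(3) unfolding I_eq by blast
      qed
      with r(1,2) show False
        unfolding I_eq by blast
    qed
  qed
qed

end
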